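(* Consider the one-dimensional Euler equations with gravitation and the semi-discrete discontinuous Galerkin (DG) scheme described in the context, built from a known stationary hydrostatic solution $\{\rho^e(x),p^e(x),u^e(x)=0\}$ with $(p^e(x))_x=-\rho^e(x)\phi_x$. The scheme is well-balanced for this stationary hydrostatic solution; that is, if ${\bf U}_h=\big(\rho_h^e,\,0,\,\tfrac{p_h^e}{\gamma-1}\big)^\top$, then for every cell $I_j$ and every test function $v\in\mathbb V_h^k$ the right-hand side of the scheme vanishes: $$h_j\sum_{\mu=1}^N\omega_\mu{\bf F}\big({\bf U}_h(x_j^{(\mu)})\big)v_x(x_j^{(\mu)})-\Big(\widehat{\bf F}_{j+\frac12}v(x_{j+\frac12}^-)-\widehat{\bf F}_{j-\frac12}v(x_{j-\frac12}^+)\Big)+\Big(0,\langle S^{[2]},v\rangle_j,\langle S^{[3]},v\rangle_j\Big)^\top={\bf 0}.$$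
   Context: **Euler equations.** Fix $\gamma>1$. States are ${\bf U}=(\rho,m,E)^\top\in\mathbb R^3$ with $u=m/\rho$ and $p=(\gamma-1)\big(E-\tfrac{m^2}{2\rho}\big)$ (ideal gas). The system is ${\bf U}_t+({\bf F}({\bf U}))_x={\bf S}({\bf U},x)$ with ${\bf F}({\bf U})=(\rho u,\ \rho u^2+p,\ (E+p)u)^\top$ and ${\bf S}=(0,-\rho\phi_x,-m\phi_x)^\top$, where $\phi(x)$ is a given static gravitational potential. **HLLC flux.** For states ${\bf U}_L,{\bf U}_R$ with positive density and pressure, let $\alpha_\pm({\bf U})=u\pm\sqrt{\gamma p/\rho}$, $S_L=\min\{\alpha_-({\bf U}_L),\alpha_-({\bf U}_R)\}$, $S_R=\max\{\alpha_+({\bf U}_L),\alpha_+({\bf U}_R)\}$, $$S_*=\frac{p_R-p_L+\rho_Lu_L(S_L-u_L)-\rho_Ru_R(S_R-u_R)}{\rho_L(S_L-u_L)-\rho_R(S_R-u_R)},$$ and for $i\in\{L,R\}$ $${\bf U}_{*i}=\rho_i\frac{S_i-u_i}{S_i-S_*}\Big(1,\ S_*,\ \frac{E_i}{\rho_i}+(S_*-u_i)\Big(S_*+\frac{p_i}{\rho_i(S_i-u_i)}\Big)\Big)^\top,\qquad {\bf F}_{*i}={\bf F}({\bf U}_i)+S_i({\bf U}_{*i}-{\bf U}_i).$$ Then ${\bf F}^{hllc}({\bf U}_L,{\bf U}_R)$ equals ${\bf F}({\bf U}_L)$ if $0\le S_L$; ${\bf F}_{*L}$ if $S_L\le0\le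 S_*$; ${\bf F}_{*R}$ if $S_*\le0\le S_R$; ${\bf F}({\bf U}_R)$ if $0\ge S_R$. **Mesh and spaces.** The spatial domain is divided into cells $I_j=(x_{j-\frac12},x_{j+\frac12})$ with $h_j=x_{j+\frac12}-x_{j-\frac12}$. $\mathbb V_h^k$ is the space of $L^2$ functions whose restriction to each $I_j$ is a polynomial of degree at most $k$; ${\bf U}_h=(\rho_h,m_h,E_h)^\top\in[\mathbb V_h^k]^3$. Superscripts $\pm$ on $x_{j+\frac12}^\pm$ denote right/left limits, and ${\bf U}_{j+\frac12}^\pm={\bf U}_h(x_{j+\frac12}^\pm)$. $\overline{(\cdot)}_j$ denotes the cell average over $I_j$. $\{x_j^{(\mu)},\omega_\mu\}_{1\le\mu\le N}$ are the $N$-point Gauss quadrature nodes and (normalized, $\sum_\mu\omega_\mu=1$) weights in $I_j$. $\rho_h^e,p_h^e\in\mathbb V_h^k$ are the ($L^2$-)projections of $\rho^e,p^e$; they are assumed positive at all points where they are evaluated (quadrature nodes and cell interfaces), and $\overline{(\rho_h^e)}_j>0$. Each cell has two neighbours; at the domain boundary the exterior (ghost) values of ${\bf U}_h,\rho_h^e,p_h^e$ are those supplied by boundary conditions and satisfy the same hypotheses. **Scheme.** Set $p^{e,\star}_{j+\frac12}=\frac12\big(p_h^e(x_{j+\frac12}^-)+p_h^e(x_{j+\frac12}^+)\big)$ and $$\widehat{\bf F}_{j+\frac12}={\bf F}^{hllc}\Big(\frac{p^{e,\star}_{j+\frac12}}{p_h^e(x_{j+\frac12}^-)}{\bf U}_{j+\frac12}^-,\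 \frac{p^{e,\star}_{j+\frac12}}{p_h^e(x_{j+\frac12}^+)}{\bf U}_{j+\frac12}^+\Big).$$ For $v\in\mathbb V_h^k$, put $$\langle S^{[2]},v\rangle_j=h_j\sum_{\mu=1}^N\omega_\mu\Big(\frac{\rho_h(x_j^{(\mu)})}{\rho_h^e(x_j^{(\mu)})}-\frac{\overline{(\rho_h)}_j}{\overline{(\rho_h^e)}_j}\Big)(p_h^e)_x(x_j^{(\mu)})v(x_j^{(\mu)})+\frac{\overline{(\rho_h)}_j}{\overline{(\rho_h^e)}_j}\Big(p^{e,\star}_{j+\frac12}v(x_{j+\frac12}^-)-p^{e,\star}_{j-\frac12}v(x_{j-\frac12}^+)-h_j\sum_{\mu=1}^N\omega_\mu p_h^e(x_j^{(\mu)})v_x(x_j^{(\mu)})\Big),$$ and let $\langle S^{[3]},v\rangle_j$ be the same expression with $\rho_h$ replaced by $m_h$ (and $\rho_h^e,p_h^e,p^{e,\star}$ unchanged). The semi-discrete DG scheme is: for all $j$ and all $v\in\mathbb V_h^k$, $$\int_{I_j}({\bf U}_h)_tv\,dx=h_j\sum_{\mu=1}^N\omega_\mu{\bf F}\big({\bf U}_h(x_j^{(\mu)})\big)v_x(x_j^{(\mu)})-\Big(\widehat{\bf F}_{j+\frac12}v(x_{j+\frac12}^-)-\widehat{\bf F}_{j-\frac12}v(x_{j-\frac12}^+)\Big)+\Big(0,\langle S^{[2]},v\rangle_j,\langle S^{[3]},v\rangle_j\Big)^\top.$$ *)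

theory Defs
  imports "HOL-Analysis.Analysis" "HOL-Computational_Algebra.Polynomial"
begin

text \<open>A state is \<open>(\<rho>, m, E)\<close>; \<open>\<gamma>\<close> is the adiabatic index.\<close>

type_synonym state = "real ^ 3"

definition velocity :: "state \<Rightarrow> real" where
  "velocity U = U $ 2 / U $ 1"

definition pressure :: "real \<Rightarrow> state \<Rightarrow> real" where
  "pressure \<gamma> U = (\<gamma> - 1) * (U $ 3 - (U $ 2)\<^sup>2 / (2 * U $ 1))"

definition flux :: "real \<Rightarrow> state \<Rightarrow> state" where
  "flux \<gamma> U = (let u = velocity U; p = pressure \<gamma> U in
     vector [U $ 1 * u, U $ 1 * u\<^sup>2 + p, (U $ 3 + p) * u])"

definition sound_speed :: "real \<Rightarrow> state \<Rightarrow> real" where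
  "sound_speed \<gamma> U = sqrt (\<gamma> * pressure \<gamma> U / U $ 1)"

definition alpha_minus :: "real \<Rightarrow> state \<Rightarrow> real" where
  "alpha_minus \<gamma> U = velocity U - sound_speed \<gamma> U"

definition alpha_plus :: "real \<Rightarrow> state \<Rightarrow> real" where
  "alpha_plus \<gamma> U = velocity U + sound_speed \<gamma> U"

definition hllc_SL :: "real \<Rightarrow> state \<Rightarrow> state \<Rightarrow> real" where
  "hllc_SL \<gamma> UL UR = min (alpha_minus \<gamma> UL) (alpha_minus \<gamma> UR)"

definition hllc_SR :: "real \<Rightarrow> state \<Rightarrow> state \<Rightarrow> real" where
  "hllc_SR \<gamma> UL UR = max (alpha_plus \<gamma> UL) (alpha_plus \<gamma> UR)"

definition hllc_Sstar :: "real \<Rightarrow> state \<Rightarrow> state \<Rightarrow> real" where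
  "hllc_Sstar \<gamma> UL UR =
    (let SL = hllc_SL \<gamma> UL UR; SR = hllc_SR \<gamma> UL UR;
         uL = velocity UL; uR = velocity UR in
     (pressure \<gamma> UR - pressure \<gamma> UL + UL $ 1 * uL * (SL - uL) - UR $ 1 * uR * (SR - uR))
       / (UL $ 1 * (SL - uL) - UR $ 1 * (SR - uR)))"

definition hllc_state :: "real \<Rightarrow> state \<Rightarrow> real \<Rightarrow> real \<Rightarrow> state" where
  "hllc_state \<gamma> U S Sstar =
    (let u = velocity U in
     (U $ 1 * ((S - u) / (S - Sstar))) *\<^sub>R
       vector [1, Sstar,
         U $ 3 / U $ 1 + (Sstar - u) * (Sstar + pressure \<gamma> U / (U $ 1 * (S - u)))])"

definition hllc_star_flux :: "real \<Rightarrow> state \<Rightarrow> real \<Rightarrow> real \<Rightarrow> state" where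
  "hllc_star_flux \<gamma> U S Sstar = flux \<gamma> U + S *\<^sub>R (hllc_state \<gamma> U S Sstar - U)"

text \<open>For \<open>\<gamma> > 1\<close> and states of positive density and pressure,
  \<open>S\<^sub>L < S\<^sub>* < S\<^sub>R\<close>, and neighbouring branches agree where a wave speed is \<open>0\<close>;
  so the order of the case distinctions is immaterial.\<close>

definition hllc_flux :: "real \<Rightarrow> state \<Rightarrow> state \<Rightarrow> state" where
  "hllc_flux \<gamma> UL UR =
    (let SL = hllc_SL \<gamma> UL UR; SR = hllc_SR \<gamma> UL UR; Sstar = hllc_Sstar \<gamma> UL UR in
     if 0 \<le> SL then flux \<gamma> UL
     else if 0 \<le> Sstar then hllc_star_flux \<gamma> UL SL Sstar
     else if 0 \<le> SR then hllc_star_flux \<gamma> UR SR Sstar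
     else flux \<gamma> UR)"

text \<open>The cells are indexed by \<open>j \<in> {1..ncells M}\<close>, and the interface \<open>x\<^bsub>j+1/2\<^esub>\<close> is
  \<open>iface M j\<close>, \<open>j \<in> {0..ncells M}\<close>; thus \<open>x\<^bsub>j-1/2\<^esub>\<close> is \<open>iface M (j - 1)\<close>.
  The node \<open>x\<^sub>j\<^sup>(\<^sup>\<mu>\<^sup>)\<close> is \<open>node M j \<mu>\<close>, with \<open>\<mu> \<in> {1..nquad M}\<close>.\<close>

record dg_mesh =
  ncells :: nat
  iface :: "nat \<Rightarrow> real"
  nquad :: nat
  node :: "nat \<Rightarrow> nat \<Rightarrow> real"
  weight :: "nat \<Rightarrow> real"

definition cell :: "dg_mesh \<Rightarrow> nat \<Rightarrow> real set" where
  "cell M j = {iface M (j - 1) <..< iface M j}"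

definition cell_width :: "dg_mesh \<Rightarrow> nat \<Rightarrow> real" where
  "cell_width M j = iface M j - iface M (j - 1)"

definition domain_of :: "dg_mesh \<Rightarrow> real set" where
  "domain_of M = {iface M 0 <..< iface M (ncells M)}"

text \<open>The \<open>N\<close>-point Gauss rule on \<open>(a, b)\<close>, normalized to total weight \<open>1\<close> (take \<open>q = 1\<close>):
  \<open>N\<close> distinct nodes and exactness for all polynomials of degree at most \<open>2 N - 1\<close>.\<close>

definition gauss_rule :: "real \<Rightarrow> real \<Rightarrow> nat \<Rightarrow> (nat \<Rightarrow> real) \<Rightarrow> (nat \<Rightarrow> real) \<Rightarrow> bool" where
  "gauss_rule a b N \<xi> \<omega> \<longleftrightarrow>
     inj_on \<xi> {1..N} \<and> \<xi> ` {1..N} \<subseteq> {a<..<b} \<and>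
     (\<forall>q :: real poly. degree q \<le> 2 * N - 1 \<longrightarrow>
        (\<Sum>\<mu> = 1..N. \<omega> \<mu> * poly q (\<xi> \<mu>)) = (LINT x:{a<..<b}|lebesgue. poly q x) / (b - a))"

definition valid_mesh :: "dg_mesh \<Rightarrow> bool" where
  "valid_mesh M \<longleftrightarrow>
     1 \<le> ncells M \<and> (\<forall>j \<in> {1..ncells M}. iface M (j - 1) < iface M j) \<and>
     1 \<le> nquad M \<and>
     (\<forall>j \<in> {1..ncells M}.
        gauss_rule (iface M (j - 1)) (iface M j) (nquad M) (node M j) (weight M))"

text \<open>Elements of \<open>V\<^sub>h\<^sup>k\<close> are represented by functions on the line; only the values inside the
  cells matter, and square integrability on the domain is automatic.\<close>

definition Vh :: "dg_mesh \<Rightarrow> nat \<Rightarrow> (real \<Rightarrow> real) set" where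
  "Vh M k = {v. \<forall>j \<in> {1..ncells M}. \<exists>q :: real poly. degree q \<le> k \<and>
                  (\<forall>x \<in> cell M j. v x = poly q x)}"

definition cell_avg :: "dg_mesh \<Rightarrow> (real \<Rightarrow> real) \<Rightarrow> nat \<Rightarrow> real" where
  "cell_avg M w j = (LINT x:cell M j|lebesgue. w x) / cell_width M j"

definition square_integrable_on :: "(real \<Rightarrow> real) \<Rightarrow> real set \<Rightarrow> bool" where
  "square_integrable_on w D \<longleftrightarrow>
     set_borel_measurable lebesgue D w \<and> set_integrable lebesgue D (\<lambda>x. (w x)\<^sup>2)"

definition is_L2_projection :: "dg_mesh \<Rightarrow> nat \<Rightarrow> (real \<Rightarrow> real) \<Rightarrow> (real \<Rightarrow> real) \<Rightarrow> bool" where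
  "is_L2_projection M k w wh \<longleftrightarrow>
     square_integrable_on w (domain_of M) \<and> wh \<in> Vh M k \<and>
     (\<forall>v \<in> Vh M k. (LINT x:domain_of M|lebesgue. wh x * v x)
                  = (LINT x:domain_of M|lebesgue. w x * v x))"

text \<open>A discrete function together with the exterior values that boundary conditions supply at
  the left and right end of the domain.\<close>

record 'a dg_fun =
  val :: "real \<Rightarrow> 'a"
  ghost_left :: 'a
  ghost_right :: 'a

text \<open>The one-sided limits \<open>w(x\<^bsub>j+1/2\<^esub>\<^sup>-)\<close> and \<open>w(x\<^bsub>j+1/2\<^esub>\<^sup>+)\<close>, \<open>j \<in> {0..ncells M}\<close>.\<close>

definition trace_minus :: "dg_mesh \<Rightarrow> ('a::t2_space) dg_fun \<Rightarrow> nat \<Rightarrow> 'a" where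
  "trace_minus M w j =
     (if j = 0 then ghost_left w else Lim (at_left (iface M j)) (val w))"

definition trace_plus :: "dg_mesh \<Rightarrow> ('a::t2_space) dg_fun \<Rightarrow> nat \<Rightarrow> 'a" where
  "trace_plus M w j =
     (if j = ncells M then ghost_right w else Lim (at_right (iface M j)) (val w))"

definition hydrostatic ::
  "(real \<Rightarrow> real) \<Rightarrow> real set \<Rightarrow> (real \<Rightarrow> real) \<Rightarrow> (real \<Rightarrow> real) \<Rightarrow> bool" where
  "hydrostatic \<phi> D \<rho>e pe \<longleftrightarrow>
     (\<forall>x \<in> D. \<phi> differentiable (at x) \<and>
              (pe has_real_derivative - \<rho>e x * deriv \<phi> x) (at x))"

definition pstar :: "dg_mesh \<Rightarrow> real dg_fun \<Rightarrow> nat \<Rightarrow> real" where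
  "pstar M ph j = (trace_minus M ph j + trace_plus M ph j) / 2"

definition num_flux :: "real \<Rightarrow> dg_mesh \<Rightarrow> real dg_fun \<Rightarrow> state dg_fun \<Rightarrow> nat \<Rightarrow> state" where
  "num_flux \<gamma> M ph U j =
     hllc_flux \<gamma> ((pstar M ph j / trace_minus M ph j) *\<^sub>R trace_minus M U j)
                ((pstar M ph j / trace_plus M ph j) *\<^sub>R trace_plus M U j)"

text \<open>\<open>\<langle>S\<^sup>[\<^sup>2\<^sup>], v\<rangle>\<^sub>j\<close> and \<open>\<langle>S\<^sup>[\<^sup>3\<^sup>], v\<rangle>\<^sub>j\<close> are the instances where \<open>w\<close> is the density and the momentum
  of the numerical solution, respectively.\<close>

definition source_approx ::
  "dg_mesh \<Rightarrow> real dg_fun \<Rightarrow> real dg_fun \<Rightarrow> (real \<Rightarrow> real) \<Rightarrow> (real \<Rightarrow> real) \<Rightarrow> nat \<Rightarrow> real" where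
  "source_approx M \<rho>h ph w v j =
     cell_width M j * (\<Sum>\<mu> = 1..nquad M. weight M \<mu> *
        (w (node M j \<mu>) / val \<rho>h (node M j \<mu>) - cell_avg M w j / cell_avg M (val \<rho>h) j) *
        deriv (val ph) (node M j \<mu>) * v (node M j \<mu>))
     + cell_avg M w j / cell_avg M (val \<rho>h) j *
        (pstar M ph j * Lim (at_left (iface M j)) v
         - pstar M ph (j - 1) * Lim (at_right (iface M (j - 1))) v
         - cell_width M j * (\<Sum>\<mu> = 1..nquad M.
             weight M \<mu> * val ph (node M j \<mu>) * deriv v (node M j \<mu>)))"

definition dg_rhs ::
  "real \<Rightarrow> dg_mesh \<Rightarrow> real dg_fun \<Rightarrow> real dg_fun \<Rightarrow> state dg_fun \<Rightarrow> (real \<Rightarrow> real) \<Rightarrow> nat \<Rightarrow> state"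
where
  "dg_rhs \<gamma> M \<rho>h ph U v j =
     cell_width M j *\<^sub>R (\<Sum>\<mu> = 1..nquad M.
        (weight M \<mu> * deriv v (node M j \<mu>)) *\<^sub>R flux \<gamma> (val U (node M j \<mu>)))
     - (Lim (at_left (iface M j)) v *\<^sub>R num_flux \<gamma> M ph U j
        - Lim (at_right (iface M (j - 1))) v *\<^sub>R num_flux \<gamma> M ph U (j - 1))
     + vector [0,
         source_approx M \<rho>h ph (\<lambda>x. val U x $ 1) v j,
         source_approx M \<rho>h ph (\<lambda>x. val U x $ 2) v j]"

text \<open>Positivity at every point where the scheme evaluates \<open>w\<close>; via the traces this includes the
  ghost values.\<close>

definition positive_at_eval_points :: "dg_mesh \<Rightarrow> real dg_fun \<Rightarrow> bool" where
  "positive_at_eval_points M w \<longleftrightarrow>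
     (\<forall>j \<in> {1..ncells M}. \<forall>\<mu> \<in> {1..nquad M}. 0 < val w (node M j \<mu>)) \<and>
     (\<forall>j \<in> {0..ncells M}. 0 < trace_minus M w j \<and> 0 < trace_plus M w j)"

definition equilibrium_state :: "real \<Rightarrow> real \<Rightarrow> real \<Rightarrow> state" where
  "equilibrium_state \<gamma> \<rho> p = vector [\<rho>, 0, p / (\<gamma> - 1)]"

end

theory Submission
  imports Defs
begin

text \<open>In the equilibrium state the velocity vanishes and the energy is proportional to the
  pressure, so the physical flux is \<open>(0, p, 0)\<close>. The scaling by \<open>p\<^sup>\<star> / p\<^sup>\<plusminus>\<close> in the numerical flux
  turns the two traces at an interface into states at rest with one common pressure \<open>p\<^sup>\<star>\<close>, possibly
  with different densities: a stationary contact discontinuity. The HLLC solver resolves such a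
  discontinuity exactly (\<open>hllc_flux_stationary_contact\<close>), hence the numerical flux is
  \<open>(0, p\<^sup>\<star>, 0)\<close> at every interface (\<open>num_flux_equilibrium\<close>).

  In the source term, \<open>\<rho>\<^sub>h\<close> coincides with \<open>\<rho>\<^sub>h\<^sup>e\<close>, so both the nodal ratio and the ratio of the cell
  averages equal \<open>1\<close>. The first sum drops out, and what remains is exactly the discrete divergence
  of the fluxes \<open>(0, p, 0)\<close> and \<open>(0, p\<^sup>\<star>, 0)\<close>, by the same quadrature and with the same interface
  values (\<open>source_approx_equilibrium\<close>). The momentum equation is therefore balanced identically,
  without any quadrature error; in the mass and the energy equation every term vanishes because
  there is no motion.\<close>

section \<open>States at rest\<close>

lemma equilibrium_state_nth [simp]:
  "equilibrium_state \<gamma> r p $ 1 = r"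
  "equilibrium_state \<gamma> r p $ 2 = 0"
  "equilibrium_state \<gamma> r p $ 3 = p / (\<gamma> - 1)"
  by (simp_all add: equilibrium_state_def)

lemma velocity_equilibrium [simp]: "velocity (equilibrium_state \<gamma> r p) = 0"
  by (simp add: velocity_def)

lemma pressure_equilibrium [simp]:
  "1 < \<gamma> \<Longrightarrow> pressure \<gamma> (equilibrium_state \<gamma> r p) = p"
  by (simp add: pressure_def)

lemma flux_equilibrium:
  "1 < \<gamma> \<Longrightarrow> flux \<gamma> (equilibrium_state \<gamma> r p) = vector [0, p, 0]"
  by (simp add: flux_def Let_def)

lemma scaleR_equilibrium:
  "c *\<^sub>R equilibrium_state \<gamma> r p = equilibrium_state \<gamma> (c * r) (c * p)"
  by (simp add: vec_eq_iff forall_3)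

section \<open>The HLLC flux at a stationary contact\<close>

text \<open>With both states at rest, the intermediate speed \<open>S\<^sub>*\<close> is \<open>0\<close>.
  Any nonzero outer speed \<open>S\<close> then cancels from the intermediate state.\<close>

lemma hllc_star_flux_equilibrium:
  assumes "r \<noteq> 0" "S \<noteq> 0"
  shows "hllc_star_flux \<gamma> (equilibrium_state \<gamma> r p) S 0 = flux \<gamma> (equilibrium_state \<gamma> r p)"
proof -
  have "hllc_state \<gamma> (equilibrium_state \<gamma> r p) S 0 = equilibrium_state \<gamma> r p"
    using assms by (simp add: hllc_state_def Let_def vec_eq_iff forall_3)
  then show ?thesis
    by (simp add: hllc_star_flux_def)
qed

text \<open>Equal pressures and vanishing velocities make the numerator of \<open>S\<^sub>*\<close> vanish, while positive
  sound speeds give \<open>S\<^sub>L < 0\<close>; the flux is thus the intermediate one on the left, which is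
  the physical flux.\<close>

lemma hllc_flux_stationary_contact:
  assumes "1 < \<gamma>" "0 < rL" "0 < rR" "0 < p"
  shows "hllc_flux \<gamma> (equilibrium_state \<gamma> rL p) (equilibrium_state \<gamma> rR p) = vector [0, p, 0]"
proof -
  let ?L = "equilibrium_state \<gamma> rL p" and ?R = "equilibrium_state \<gamma> rR p"
  have SL: "hllc_SL \<gamma> ?L ?R < 0"
    using assms by (simp add: hllc_SL_def alpha_minus_def sound_speed_def min_less_iff_disj)
  have "hllc_Sstar \<gamma> ?L ?R = 0"
    using assms by (simp add: hllc_Sstar_def Let_def)
  then show ?thesis
    using SL assms by (simp add: hllc_flux_def Let_def hllc_star_flux_equilibrium flux_equilibrium)
qed

section \<open>Traces of discrete functions\<close>

lemma cell_eventually_at_left: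
  assumes "valid_mesh M" "j \<in> {1..ncells M}"
  shows "\<forall>\<^sub>F x in at_left (iface M j). x \<in> cell M j"
  unfolding cell_def using assms by (intro eventually_at_left_real) (simp add: valid_mesh_def)

lemma cell_eventually_at_right:
  assumes "valid_mesh M" "j \<in> {1..ncells M}"
  shows "\<forall>\<^sub>F x in at_right (iface M (j - 1)). x \<in> cell M j"
  unfolding cell_def using assms by (intro eventually_at_right_real) (simp add: valid_mesh_def)

lemma node_in_cell:
  assumes "valid_mesh M" "j \<in> {1..ncells M}" "\<mu> \<in> {1..nquad M}"
  shows "node M j \<mu> \<in> cell M j"
  using assms unfolding valid_mesh_def gauss_rule_def cell_def by blast

lemma Vh_tendsto_within_cell:
  assumes "w \<in> Vh M k" "j \<in> {1..ncells M}" "\<forall>\<^sub>F x in at a within S. x \<in> cell M j"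
  shows "\<exists>l. (w \<longlongrightarrow> l) (at a within S)"
proof -
  obtain q where q: "\<forall>x \<in> cell M j. w x = poly q x"
    using assms(1,2) unfolding Vh_def by blast
  have "\<forall>\<^sub>F x in at a within S. poly q x = w x"
    using assms(3) by eventually_elim (simp add: q)
  then have "(w \<longlongrightarrow> poly q a) (at a within S)"
    by (rule Lim_transform_eventually[rotated]) (intro tendsto_intros)
  then show ?thesis by blast
qed

text \<open>\<open>Lim\<close> is a definite description, so it commutes with the formation of equilibrium states only once
  the limits of density and pressure are known to exist.\<close>

lemma Lim_equilibrium:
  fixes U :: "real \<Rightarrow> state" and r p :: "real \<Rightarrow> real"
  assumes "F \<noteq> bot" "(r \<longlongrightarrow> a) F" "(p \<longlongrightarrow> b) F"
    and "\<forall>\<^sub>F x in F. U x = equilibrium_state \<gamma> (r x) (p x)"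
  shows "Lim F U = equilibrium_state \<gamma> (Lim F r) (Lim F p)"
proof -
  have "((\<lambda>x. equilibrium_state \<gamma> (r x) (p x) $ i) \<longlongrightarrow> equilibrium_state \<gamma> a b $ i) F" for i
    using exhaust_3[of i] assms(2,3)
    by (elim disjE) (simp_all add: divide_inverse tendsto_mult_right)
  then have "((\<lambda>x. equilibrium_state \<gamma> (r x) (p x)) \<longlongrightarrow> equilibrium_state \<gamma> a b) F"
    by (rule vec_tendstoI)
  moreover have "\<forall>\<^sub>F x in F. equilibrium_state \<gamma> (r x) (p x) = U x"
    using assms(4) by eventually_elim simp
  ultimately have "(U \<longlongrightarrow> equilibrium_state \<gamma> a b) F"
    by (rule Lim_transform_eventually)
  then show ?thesis
    using assms(1-3) by (simp add: tendsto_Lim)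
qed

lemma Lim_equilibrium_within_cell:
  assumes "at a within S \<noteq> bot" "j \<in> {1..ncells M}" "\<forall>\<^sub>F x in at a within S. x \<in> cell M j"
    and "r \<in> Vh M k" "p \<in> Vh M k"
    and "\<forall>x \<in> cell M j. U x = equilibrium_state \<gamma> (r x) (p x)"
  shows "Lim (at a within S) U
       = equilibrium_state \<gamma> (Lim (at a within S) r) (Lim (at a within S) p)"
proof -
  obtain l l' where "(r \<longlongrightarrow> l) (at a within S)" "(p \<longlongrightarrow> l') (at a within S)"
    using Vh_tendsto_within_cell assms by metis
  moreover have "\<forall>\<^sub>F x in at a within S. U x = equilibrium_state \<gamma> (r x) (p x)"
    using assms(3) by eventually_elim (simp add: assms(6))
  ultimately show ?thesis
    using assms(1) by (intro Lim_equilibrium)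
qed

section \<open>The scheme at equilibrium\<close>

locale discrete_equilibrium =
  fixes \<gamma> :: real and M :: dg_mesh and k :: nat
    and \<rho>h ph :: "real dg_fun" and U :: "state dg_fun"
  assumes gamma: "1 < \<gamma>"
    and mesh: "valid_mesh M"
    and rho_Vh: "val \<rho>h \<in> Vh M k"
    and p_Vh: "val ph \<in> Vh M k"
    and rho_pos: "positive_at_eval_points M \<rho>h"
    and p_pos: "positive_at_eval_points M ph"
    and rho_avg: "\<forall>j \<in> {1..ncells M}. 0 < cell_avg M (val \<rho>h) j"
    and U_eq: "\<forall>j \<in> {1..ncells M}. \<forall>x \<in> cell M j.
                 val U x = equilibrium_state \<gamma> (val \<rho>h x) (val ph x)"
    and ghost_left_eq: "ghost_left U = equilibrium_state \<gamma> (ghost_left \<rho>h) (ghost_left ph)"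
    and ghost_right_eq: "ghost_right U = equilibrium_state \<gamma> (ghost_right \<rho>h) (ghost_right ph)"
begin

lemma trace_minus_U:
  assumes "j \<in> {0..ncells M}"
  shows "trace_minus M U j = equilibrium_state \<gamma> (trace_minus M \<rho>h j) (trace_minus M ph j)"
proof (cases "j = 0")
  case True
  then show ?thesis by (simp add: trace_minus_def ghost_left_eq)
next
  case False
  then have j: "j \<in> {1..ncells M}" using assms by simp
  show ?thesis
    using False
      Lim_equilibrium_within_cell[OF _ j cell_eventually_at_left[OF mesh j] rho_Vh p_Vh
        bspec[OF U_eq j]]
    by (simp add: trace_minus_def)
qed

lemma trace_plus_U:
  assumes "j \<in> {0..ncells M}"
  shows "trace_plus M U j = equilibrium_state \<gamma> (trace_plus M \<rho>h j) (trace_plus M ph j)"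
proof (cases "j = ncells M")
  case True
  then show ?thesis by (simp add: trace_plus_def ghost_right_eq)
next
  case False
  \<comment> \<open>The right limit at interface \<open>j\<close> is taken from inside cell \<open>j + 1\<close>.\<close>
  then have j: "Suc j \<in> {1..ncells M}" using assms by simp
  show ?thesis
    using False
      Lim_equilibrium_within_cell[OF _ j cell_eventually_at_right[OF mesh j] rho_Vh p_Vh
        bspec[OF U_eq j]]
    by (simp add: trace_plus_def)
qed

text \<open>The scaling by \<open>p\<^sup>\<star> / p\<^sup>\<plusminus>\<close> removes the pressure jump and leaves only a density jump.\<close>

lemma num_flux_equilibrium:
  assumes "j \<in> {0..ncells M}"
  shows "num_flux \<gamma> M ph U j = vector [0, pstar M ph j, 0]"
proof -
  have pos: "0 < trace_minus M \<rho>h j" "0 < trace_plus M \<rho>h j"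
      "0 < trace_minus M ph j" "0 < trace_plus M ph j"
    using rho_pos p_pos assms by (auto simp: positive_at_eval_points_def)
  then have "0 < pstar M ph j" by (simp add: pstar_def)
  then show ?thesis
    using pos assms gamma
    by (simp add: num_flux_def trace_minus_U trace_plus_U scaleR_equilibrium
        hllc_flux_stationary_contact)
qed

lemma val_U_node:
  assumes "j \<in> {1..ncells M}" "\<mu> \<in> {1..nquad M}"
  shows "val U (node M j \<mu>) = equilibrium_state \<gamma> (val \<rho>h (node M j \<mu>)) (val ph (node M j \<mu>))"
  using U_eq node_in_cell[OF mesh assms] assms(1) by blast

lemma cell_avg_density:
  assumes "j \<in> {1..ncells M}"
  shows "cell_avg M (\<lambda>x. val U x $ 1) j = cell_avg M (val \<rho>h) j"
proof -
  have "(LINT x:cell M j|lebesgue. val U x $ 1) = (LINT x:cell M j|lebesgue. val \<rho>h x)"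
    using U_eq assms by (intro set_lebesgue_integral_cong) (auto simp: cell_def)
  then show ?thesis by (simp add: cell_avg_def)
qed

lemma cell_avg_momentum:
  assumes "j \<in> {1..ncells M}"
  shows "cell_avg M (\<lambda>x. val U x $ 2) j = 0"
proof -
  have "(LINT x:cell M j|lebesgue. val U x $ 2) = (LINT x:cell M j|lebesgue. 0)"
    using U_eq assms by (intro set_lebesgue_integral_cong) (auto simp: cell_def)
  then show ?thesis by (simp add: cell_avg_def set_lebesgue_integral_def)
qed

text \<open>Both density ratios in \<open>S\<^sup>[\<^sup>2\<^sup>]\<close> are \<open>1\<close> and both momentum ratios in \<open>S\<^sup>[\<^sup>3\<^sup>]\<close> are \<open>0\<close>. In each case
  the nodal ratio equals the averaged one, and only the second summand can survive.\<close>

lemma source_approx_equilibrium: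
  assumes "j \<in> {1..ncells M}"
  shows "source_approx M \<rho>h ph (\<lambda>x. val U x $ 1) v j =
           pstar M ph j * Lim (at_left (iface M j)) v
           - pstar M ph (j - 1) * Lim (at_right (iface M (j - 1))) v
           - cell_width M j * (\<Sum>\<mu> = 1..nquad M.
               weight M \<mu> * val ph (node M j \<mu>) * deriv v (node M j \<mu>))"
    and "source_approx M \<rho>h ph (\<lambda>x. val U x $ 2) v j = 0"
proof -
  have avg: "cell_avg M (val \<rho>h) j \<noteq> 0"
    using rho_avg assms by fastforce
  have node: "val \<rho>h (node M j \<mu>) \<noteq> 0" if "\<mu> \<in> {1..nquad M}" for \<mu>
    using rho_pos assms that unfolding positive_at_eval_points_def by (metis less_irrefl)
  have "(\<Sum>\<mu> = 1..nquad M. weight M \<mu> *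
        (val U (node M j \<mu>) $ 1 / val \<rho>h (node M j \<mu>)
          - cell_avg M (\<lambda>x. val U x $ 1) j / cell_avg M (val \<rho>h) j) *
        deriv (val ph) (node M j \<mu>) * v (node M j \<mu>)) = 0"
    using assms by (intro sum.neutral ballI) (simp add: val_U_node cell_avg_density avg node)
  then show "source_approx M \<rho>h ph (\<lambda>x. val U x $ 1) v j =
           pstar M ph j * Lim (at_left (iface M j)) v
           - pstar M ph (j - 1) * Lim (at_right (iface M (j - 1))) v
           - cell_width M j * (\<Sum>\<mu> = 1..nquad M.
               weight M \<mu> * val ph (node M j \<mu>) * deriv v (node M j \<mu>))"
    using assms avg by (simp add: source_approx_def cell_avg_density)
  have "(\<Sum>\<mu> = 1..nquad M. weight M \<mu> *
        (val U (node M j \<mu>) $ 2 / val \<rho>h (node M j \<mu>)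
          - cell_avg M (\<lambda>x. val U x $ 2) j / cell_avg M (val \<rho>h) j) *
        deriv (val ph) (node M j \<mu>) * v (node M j \<mu>)) = 0"
    using assms by (intro sum.neutral ballI) (simp add: val_U_node cell_avg_momentum)
  then show "source_approx M \<rho>h ph (\<lambda>x. val U x $ 2) v j = 0"
    using assms by (simp add: source_approx_def cell_avg_momentum)
qed

lemma dg_rhs_equilibrium:
  assumes j: "j \<in> {1..ncells M}"
  shows "dg_rhs \<gamma> M \<rho>h ph U v j = 0"
proof -
  have "(\<Sum>\<mu> = 1..nquad M.
          (weight M \<mu> * deriv v (node M j \<mu>)) *\<^sub>R flux \<gamma> (val U (node M j \<mu>)))
      = (\<Sum>\<mu> = 1..nquad M.
          (weight M \<mu> * deriv v (node M j \<mu>)) *\<^sub>R vector [0, val ph (node M j \<mu>), 0])"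
    using j gamma by (intro sum.cong refl) (simp add: val_U_node flux_equilibrium)
  moreover have "num_flux \<gamma> M ph U j = vector [0, pstar M ph j, 0]"
      "num_flux \<gamma> M ph U (j - 1) = vector [0, pstar M ph (j - 1), 0]"
    using j by (auto intro!: num_flux_equilibrium)
  ultimately show ?thesis
    unfolding dg_rhs_def source_approx_equilibrium[OF j]
    by (simp add: vec_eq_iff forall_3 mult_ac)
qed

end

theorem theorem3p1:
  fixes \<gamma> :: real and M :: dg_mesh and k :: nat
    and \<phi> \<rho>e pe :: "real \<Rightarrow> real"
    and \<rho>h ph :: "real dg_fun" and U :: "state dg_fun"
  assumes "1 < \<gamma>"
    and "valid_mesh M"
    and "hydrostatic \<phi> (domain_of M) \<rho>e pe"
    and "is_L2_projection M k \<rho>e (val \<rho>h)"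
    and "is_L2_projection M k pe (val ph)"
    and "positive_at_eval_points M \<rho>h"
    and "positive_at_eval_points M ph"
    and "\<forall>j \<in> {1..ncells M}. 0 < cell_avg M (val \<rho>h) j"
    and "\<forall>i. (\<lambda>x. val U x $ i) \<in> Vh M k"
    and "\<forall>j \<in> {1..ncells M}. \<forall>x \<in> cell M j.
           val U x = equilibrium_state \<gamma> (val \<rho>h x) (val ph x)"
    and "ghost_left U = equilibrium_state \<gamma> (ghost_left \<rho>h) (ghost_left ph)"
    and "ghost_right U = equilibrium_state \<gamma> (ghost_right \<rho>h) (ghost_right ph)"
  shows "\<forall>j \<in> {1..ncells M}. \<forall>v \<in> Vh M k. dg_rhs \<gamma> M \<rho>h ph U v j = 0"
proof -
  have "val \<rho>h \<in> Vh M k" "val ph \<in> Vh M k"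
    using assms(4,5) by (auto simp: is_L2_projection_def)
  then interpret discrete_equilibrium \<gamma> M k \<rho>h ph U
    using assms by unfold_locales
  show ?thesis
    by (simp add: dg_rhs_equilibrium)
qed

end
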